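(* For every real $p$ with $0<p\le 1$, we have $\mathbb R^{\mathbb N}/\ell_p\sim_B\mathbb R^{\mathbb N}/\ell_1$.
   Context: For $p>0$, $\mathbb R^{\mathbb N}/\ell_p$ is the equivalence relation on $\mathbb R^{\mathbb N}$ given by $(x,y)\in\mathbb R^{\mathbb N}/\ell_p\iff x-y\in\ell_p\iff\sum_{n\in\mathbb N}|x(n)-y(n)|^p<+\infty$. For equivalence relations $E,F$ on Polish spaces $X,Y$, $E\le_B F$ means that there is a Borel function $\theta:X\to Y$ with $(x,y)\in E\iff(\theta(x),\theta(y))\in F$ for all $x,y\in X$; $E\sim_B F$ means $E\le_B F$ and $F\le_B E$. *)

theory Defs
  imports "HOL-Analysis.Analysis"
begin

text \<open>
  The space of real sequences is the type \<^typ>\<open>nat \<Rightarrow> real\<close> with the product topology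
  of \<^theory>\<open>HOL-Analysis.Function_Topology\<close>, which is an instance of
  \<^class>\<open>polish_space\<close>; Borel functions are measurable functions between the Borel
  sigma-algebras of the topologies.
\<close>

definition ell :: "real \<Rightarrow> (nat \<Rightarrow> real) set" where
  "ell p = {x. summable (\<lambda>n. \<bar>x n\<bar> powr p)}"

definition mod_ell :: "real \<Rightarrow> (nat \<Rightarrow> real) rel" where
  "mod_ell p = {(x, y). (\<lambda>n. x n - y n) \<in> ell p}"

definition borel_reducible :: "'a::polish_space rel \<Rightarrow> 'b::polish_space rel \<Rightarrow> bool"
    (infix "\<le>\<^sub>B" 50) where
  "E \<le>\<^sub>B F \<longleftrightarrow>
     (\<exists>\<theta> \<in> borel_measurable borel. \<forall>x y. (x, y) \<in> E \<longleftrightarrow> (\<theta> x, \<theta> y) \<in> F)"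

definition borel_bireducible :: "'a::polish_space rel \<Rightarrow> 'b::polish_space rel \<Rightarrow> bool"
    (infix "\<sim>\<^sub>B" 50) where
  "E \<sim>\<^sub>B F \<longleftrightarrow> E \<le>\<^sub>B F \<and> F \<le>\<^sub>B E"

lemma ell_add:
  assumes p: "0 < p" and "x \<in> ell p" "y \<in> ell p"
  shows "(\<lambda>n. x n + y n) \<in> ell p"
proof -
  have le: "\<bar>a + b\<bar> powr p \<le> 2 powr p * (\<bar>a\<bar> powr p + \<bar>b\<bar> powr p)" for a b :: real
  proof -
    have "\<bar>a + b\<bar> powr p \<le> (2 * max \<bar>a\<bar> \<bar>b\<bar>) powr p"
      using p by (intro powr_mono2) auto
    also have "\<dots> = 2 powr p * max \<bar>a\<bar> \<bar>b\<bar> powr p"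
      by (simp add: powr_mult)
    also have "\<dots> \<le> 2 powr p * (\<bar>a\<bar> powr p + \<bar>b\<bar> powr p)"
      by (intro mult_left_mono) (auto simp: max_def)
    finally show ?thesis .
  qed
  have "summable (\<lambda>n. 2 powr p * (\<bar>x n\<bar> powr p + \<bar>y n\<bar> powr p))"
    using assms by (intro summable_mult summable_add) (auto simp: ell_def)
  then have "summable (\<lambda>n. \<bar>x n + y n\<bar> powr p)"
    by (rule summable_comparison_test') (use le in auto)
  then show ?thesis
    by (simp add: ell_def)
qed

lemma equiv_mod_ell:
  assumes "0 < p"
  shows "equiv UNIV (mod_ell p)"
proof (rule equivI)
  show "refl (mod_ell p)"
    by (auto simp: refl_on_def mod_ell_def ell_def)
  show "sym (mod_ell p)"
    by (auto simp: sym_def mod_ell_def ell_def abs_minus_commute)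
  show "trans (mod_ell p)"
  proof (rule transI)
    fix x y z assume "(x, y) \<in> mod_ell p" "(y, z) \<in> mod_ell p"
    then have "(\<lambda>n. (x n - y n) + (y n - z n)) \<in> ell p"
      using assms by (intro ell_add) (auto simp: mod_ell_def)
    then show "(x, z) \<in> mod_ell p"
      by (simp add: mod_ell_def)
  qed
qed auto

end

theory Submission imports Defs begin

text \<open>
  Both reductions act coordinatewise through a map \<open>f\<close> from the line to sequences over a countable
  index set for which \<open>\<Sum>i. \<bar>f i x - f i y\<bar>\<^sup>q\<close> is comparable to \<open>\<bar>x - y\<bar>\<^sup>p\<close>, up to an error that
  is summable over the coordinates.

  For \<open>\<ell>\<^sub>p\<close> into \<open>\<ell>\<^sub>1\<close> with \<open>p < 1\<close>, take the Assouad embedding of the snowflake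
  \<open>\<bar>x - y\<bar>\<^sup>p\<close>: the functions \<open>2\<^sup>-\<^sup>j\<^sup>p cos (2\<^sup>j x)\<close> and \<open>2\<^sup>-\<^sup>j\<^sup>p sin (2\<^sup>j x)\<close> for all integers \<open>j\<close>.
  For \<open>\<ell>\<^sub>1\<close> into \<open>\<ell>\<^sub>p\<close>, the indicators of the half-lines \<open>[m 2\<^sup>-\<^sup>n, \<infinity>)\<close>, scaled so that each step
  contributes \<open>2\<^sup>-\<^sup>n\<close>, count the grid points between \<open>x n\<close> and \<open>y n\<close>, and so measure
  \<open>\<bar>x n - y n\<bar>\<close> with error at most \<open>2\<^sup>-\<^sup>n\<close>.
\<close>

section \<open>Reductions acting coordinate by coordinate\<close>

text \<open>All values \<open>f n i (x n)\<close> are listed in one sequence. Nonnegative terms may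
  be summed row by row, so only the row sums \<open>s n (x n) (y n)\<close> matter, and the two
  bounds allow comparison in both directions since \<open>e\<close> is summable.\<close>

lemma borel_reducible_mod_ell_coordinatewise:
  fixes f :: "nat \<Rightarrow> 'i::countable \<Rightarrow> real \<Rightarrow> real"
  assumes meas: "\<And>n i. f n i \<in> borel_measurable borel"
    and e: "summable e"
    and has: "\<And>n x y. ((\<lambda>i. \<bar>f n i x - f n i y\<bar> powr q) has_sum s n x y) UNIV"
    and upper: "\<And>n x y. s n x y \<le> A * \<bar>x - y\<bar> powr p + e n"
    and lower: "\<And>n x y. \<bar>x - y\<bar> powr p \<le> C * s n x y + e n"
  shows "mod_ell p \<le>\<^sub>B mod_ell q"
proof -
  \<comment> \<open>\<open>to_nat\<close> need not be onto; positions outside its range hold 0 for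
    every \<open>x\<close>, so they cancel in differences.\<close>
  define \<theta> :: "(nat \<Rightarrow> real) \<Rightarrow> nat \<Rightarrow> real" where
    "\<theta> x k = (if k \<in> range (to_nat :: nat \<times> 'i \<Rightarrow> nat)
      then case from_nat k of (n, i) \<Rightarrow> f n i (x n) else 0)" for x k
  have \<theta>_to_nat: "\<theta> x (to_nat (n, i)) = f n i (x n)" for x n i
    by (simp add: \<theta>_def)
  have \<theta>_0: "\<theta> x k = 0" if "k \<notin> range (to_nat :: nat \<times> 'i \<Rightarrow> nat)" for x k
    using that by (simp add: \<theta>_def)
  have "\<theta> \<in> borel_measurable borel"
  proof (rule measurable_coordinatewise_then_product)
    fix k
    show "(\<lambda>x. \<theta> x k) \<in> borel_measurable borel"
    proof (cases "k \<in> range (to_nat :: nat \<times> 'i \<Rightarrow> nat)")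
      case True
      then obtain n i where k: "k = to_nat (n :: nat, i :: 'i)"
        by auto
      show ?thesis
        unfolding k \<theta>_to_nat
        by (rule measurable_compose[OF measurable_product_coordinates meas])
    qed (simp add: \<theta>_0)
  qed
  moreover have "(x, y) \<in> mod_ell p \<longleftrightarrow> (\<theta> x, \<theta> y) \<in> mod_ell q" for x y
  proof -
    define S where "S n = s n (x n) (y n)" for n
    have S: "((\<lambda>i. \<bar>f n i (x n) - f n i (y n)\<bar> powr q) has_sum S n) UNIV" for n
      unfolding S_def by (rule has)
    have S_nonneg: "0 \<le> S n" for n
      by (rule has_sum_nonneg[OF S]) simp
    have "(\<theta> x, \<theta> y) \<in> mod_ell q \<longleftrightarrow> (\<lambda>k. \<bar>\<theta> x k - \<theta> y k\<bar> powr q) summable_on UNIV"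
      by (simp add: mod_ell_def ell_def summable_on_UNIV_nonneg_real_iff)
    also have "\<dots> \<longleftrightarrow> (\<lambda>k. \<bar>\<theta> x k - \<theta> y k\<bar> powr q) summable_on range (to_nat :: nat \<times> 'i \<Rightarrow> nat)"
      by (rule summable_on_cong_neutral) (auto simp: \<theta>_0)
    also have "\<dots> \<longleftrightarrow> (\<lambda>(n, i). \<bar>f n i (x n) - f n i (y n)\<bar> powr q) summable_on (UNIV \<times> UNIV)"
      by (subst summable_on_reindex) (auto simp: o_def \<theta>_to_nat case_prod_beta' intro!: summable_on_cong)
    also have "\<dots> \<longleftrightarrow> S summable_on UNIV"
    proof -
      have "(\<lambda>(n, i). \<bar>f n i (x n) - f n i (y n)\<bar> powr q) summable_on (UNIV \<times> UNIV) \<longleftrightarrow>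
            (\<lambda>z. norm (case z of (n, i) \<Rightarrow> \<bar>f n i (x n) - f n i (y n)\<bar> powr q)) summable_on (UNIV \<times> UNIV)"
        by (rule summable_on_cong) auto
      also have "\<dots> \<longleftrightarrow> S summable_on UNIV"
        using has_sum_imp_summable[OF S] S_nonneg unfolding Infinite_Sum.abs_summable_on_Sigma_iff
        by (simp add: infsumI[OF S])
      finally show ?thesis .
    qed
    also have "\<dots> \<longleftrightarrow> summable S"
      by (rule summable_on_UNIV_nonneg_real_iff) (rule S_nonneg)
    also have "\<dots> \<longleftrightarrow> summable (\<lambda>n. \<bar>x n - y n\<bar> powr p)"
    proof
      assume "summable S"
      then have "summable (\<lambda>n. C * S n + e n)"
        by (intro summable_add summable_mult e)
      then show "summable (\<lambda>n. \<bar>x n - y n\<bar> powr p)"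
        by (rule summable_comparison_test') (use lower in \<open>auto simp: S_def\<close>)
    next
      assume "summable (\<lambda>n. \<bar>x n - y n\<bar> powr p)"
      then have "summable (\<lambda>n. A * \<bar>x n - y n\<bar> powr p + e n)"
        by (intro summable_add summable_mult e)
      then show "summable S"
        by (rule summable_comparison_test') (use upper S_nonneg in \<open>auto simp: S_def\<close>)
    qed
    finally show ?thesis
      by (simp add: mod_ell_def ell_def)
  qed
  ultimately show ?thesis
    unfolding borel_reducible_def by blast
qed

section \<open>Counting dyadic grid points\<close>

lemma mod_ell_1_borel_reducible:
  assumes "0 < p"
  shows "mod_ell 1 \<le>\<^sub>B mod_ell p"
proof (rule borel_reducible_mod_ell_coordinatewise)
  define f :: "nat \<Rightarrow> int \<Rightarrow> real \<Rightarrow> real" where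
    "f n m x = (if of_int m \<le> 2 ^ n * x then ((1/2) ^ n) powr (1 / p) else 0)" for n m x
  show "f n m \<in> borel_measurable borel" for n m
    unfolding f_def by measurable
  show "summable (\<lambda>n. (1/2) ^ n :: real)"
    by (simp add: summable_geometric)
  define s :: "nat \<Rightarrow> real \<Rightarrow> real \<Rightarrow> real" where
    "s n x y = (1/2) ^ n * \<bar>of_int (\<lfloor>2 ^ n * x\<rfloor> - \<lfloor>2 ^ n * y\<rfloor>)\<bar>" for n x y
  show "((\<lambda>m. \<bar>f n m x - f n m y\<bar> powr p) has_sum s n x y) UNIV" for n x y
  proof -
    define a b where "a = \<lfloor>2 ^ n * x\<rfloor>" and "b = \<lfloor>2 ^ n * y\<rfloor>"
    \<comment> \<open>The two indicators differ exactly for \<open>m\<close> in this half-open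
      interval, because \<open>m\<close> lies below a real number iff it lies below its floor. The
      exponent \<open>1 / p\<close> in \<open>f\<close> makes each such term
      \<open>(1/2) ^ n\<close>.\<close>
    have "((\<lambda>m. (1/2) ^ n :: real) has_sum (\<Sum>m\<in>{min a b<..max a b}. (1/2) ^ n)) {min a b<..max a b}"
      by (rule has_sum_finite) simp
    also have "(\<Sum>m\<in>{min a b<..max a b}. (1/2) ^ n) = s n x y"
      by (simp add: s_def a_def b_def min_def max_def)
    also have "((\<lambda>m. (1/2) ^ n) has_sum s n x y) {min a b<..max a b} \<longleftrightarrow>
      ((\<lambda>m. \<bar>f n m x - f n m y\<bar> powr p) has_sum s n x y) UNIV"
      using assms
      by (intro has_sum_cong_neutral)
        (auto simp: f_def a_def b_def le_floor_iff [symmetric] powr_powr)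
    finally show ?thesis .
  qed
  have grid: "\<bar>s n x y - \<bar>x - y\<bar>\<bar> \<le> (1/2) ^ n" for n x y
  proof -
    have "\<bar>\<bar>of_int (\<lfloor>2 ^ n * x\<rfloor> - \<lfloor>2 ^ n * y\<rfloor>)\<bar> - \<bar>2 ^ n * x - 2 ^ n * y\<bar>\<bar> \<le> 1"
      by linarith
    then have "(1/2) ^ n * \<bar>\<bar>of_int (\<lfloor>2 ^ n * x\<rfloor> - \<lfloor>2 ^ n * y\<rfloor>)\<bar> - \<bar>2 ^ n * x - 2 ^ n * y\<bar>\<bar> \<le> (1/2) ^ n"
      by (simp add: mult_left_le)
    moreover have "(1/2) ^ n * \<bar>2 ^ n * x - 2 ^ n * y\<bar> = \<bar>x - y\<bar>"
      by (simp add: right_diff_distrib [symmetric] abs_mult power_divide)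
    moreover have "(1/2) ^ n * \<bar>u - v\<bar> = \<bar>(1/2) ^ n * u - (1/2) ^ n * v\<bar>" for u v :: real
      by (simp add: right_diff_distrib [symmetric] abs_mult)
    ultimately show ?thesis
      by (simp add: s_def)
  qed
  show "s n x y \<le> 1 * \<bar>x - y\<bar> powr 1 + (1/2) ^ n" for n x y
    using grid[of n x y] by simp
  show "\<bar>x - y\<bar> powr 1 \<le> 1 * s n x y + (1/2) ^ n" for n x y
    using grid[of n x y] by simp
qed

section \<open>Trigonometric snowflake embedding\<close>

lemma abs_cos_diff_le: "\<bar>cos a - cos b\<bar> \<le> \<bar>a - b\<bar>" for a b :: real
proof -
  have "\<bar>cos a - cos b\<bar> = 2 * (\<bar>sin ((a + b) / 2)\<bar> * \<bar>sin ((b - a) / 2)\<bar>)"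
    by (simp add: cos_diff_cos abs_mult)
  also have "\<dots> \<le> 2 * (1 * \<bar>(b - a) / 2\<bar>)"
    by (intro mult_left_mono mult_mono abs_sin_x_le_abs_x) auto
  finally show ?thesis by simp
qed

lemma abs_sin_diff_le: "\<bar>sin a - sin b\<bar> \<le> \<bar>a - b\<bar>" for a b :: real
  using abs_cos_diff_le[of "pi / 2 - a" "pi / 2 - b"]
  by (simp add: cos_diff)

text \<open>Twice the left side is the squared chord between two points of the unit circle. Each
  coordinate difference \<open>t\<close> is at most 2 in absolute value, so its square is at most
  twice its absolute value.\<close>

lemma one_minus_cos_diff_le:
  "1 - cos (a - b) \<le> \<bar>cos a - cos b\<bar> + \<bar>sin a - sin b\<bar>" for a b :: real
proof -
  have sq: "t\<^sup>2 \<le> 2 * \<bar>t\<bar>" if "\<bar>t\<bar> \<le> 2" for t :: real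
    using mult_right_mono[OF that, of "\<bar>t\<bar>"] by (simp add: power2_eq_square)
  have "2 * (1 - cos (a - b)) = (cos a - cos b)\<^sup>2 + (sin a - sin b)\<^sup>2"
    using sin_cos_squared_add[of a] sin_cos_squared_add[of b]
    by (simp add: cos_diff power2_eq_square algebra_simps)
  also have "\<dots> \<le> 2 * \<bar>cos a - cos b\<bar> + 2 * \<bar>sin a - sin b\<bar>"
    using abs_cos_le_one[of a] abs_cos_le_one[of b] abs_sin_le_one[of a] abs_sin_le_one[of b]
    by (intro add_mono sq) linarith+
  finally show ?thesis by simp
qed

text \<open>Two geometric tails: for positive \<open>i\<close> the minimum is 2 and the ratio is
  \<open>2 powr - p\<close>; for negative \<open>i\<close> the minimum decays and, going down, the
  ratio is \<open>2 powr - (1 - p)\<close>, which is where \<open>p < 1\<close> enters.\<close>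

lemma summable_on_snowflake_weights:
  fixes p :: real
  assumes "0 < p" "p < 1"
  shows "(\<lambda>i::int. 2 powr - (of_int i * p) * min 2 (2 powr (of_int i + 1))) summable_on UNIV"
    (is "?b summable_on _")
proof -
  have geometric: "(\<lambda>n::nat. 2 * (2 powr - c) ^ n :: real) summable_on UNIV" if "0 < c" for c :: real
    using that by (subst summable_on_UNIV_nonneg_real_iff)
      (auto intro!: summable_mult summable_geometric simp: powr_less_one)
  have "?b \<circ> int summable_on UNIV"
  proof (rule summable_on_comparison_test[OF geometric[OF assms(1)]])
    fix n :: nat
    show "(?b \<circ> int) n \<le> 2 * (2 powr - p) ^ n"
      by (simp add: powr_powr flip: powr_realpow) (simp add: mult.commute)
  qed simp
  moreover have "?b \<circ> (\<lambda>n. - int n) summable_on UNIV"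
  proof (rule summable_on_comparison_test[OF geometric[of "1 - p"]])
    fix n :: nat
    have "(?b \<circ> (\<lambda>n. - int n)) n \<le> 2 powr (real n * p) * 2 powr (1 - real n)"
      by (simp add: mult_left_mono)
    also have "\<dots> = 2 powr (1 + - (1 - p) * real n)"
      by (simp add: algebra_simps flip: powr_add)
    also have "\<dots> = 2 powr 1 * (2 powr - (1 - p)) powr real n"
      by (simp only: powr_add powr_powr)
    also have "\<dots> = 2 * (2 powr - (1 - p)) ^ n"
      by (simp add: powr_realpow)
    finally show "(?b \<circ> (\<lambda>n. - int n)) n \<le> 2 * (2 powr - (1 - p)) ^ n" .
  qed (use assms in simp_all)
  ultimately have "?b summable_on (range int \<union> range (\<lambda>n. - int n))"
    by (intro summable_on_union) (simp_all add: summable_on_reindex inj_on_def)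
  also have "range int \<union> range (\<lambda>n. - int n) = UNIV"
    by (auto intro: int_cases2)
  finally show ?thesis .
qed

lemma mod_ell_borel_reducible_1:
  fixes p :: real
  assumes p: "0 < p" "p < 1"
  shows "mod_ell p \<le>\<^sub>B mod_ell 1"
proof -
  define w :: "bool \<Rightarrow> real \<Rightarrow> real" where "w c = (if c then cos else sin)" for c
  define f :: "int \<times> bool \<Rightarrow> real \<Rightarrow> real" where
    "f = (\<lambda>(j, c) x. 2 powr - (of_int j * p) * w c (2 powr of_int j * x))"
  \<comment> \<open>Majorant of the term at scale \<open>i\<close> for points at distance between 1
    and 2; other distances reduce to this by shifting the scale.\<close>
  define b :: "int \<Rightarrow> real" where
    "b i = 2 powr - (of_int i * p) * min 2 (2 powr (of_int i + 1))" for i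
  define s where "s x y = (\<Sum>\<^sub>\<infinity>i. \<bar>f i x - f i y\<bar>)" for x y
  define B where "B = (\<Sum>\<^sub>\<infinity>i\<in>UNIV \<times> (UNIV :: bool set). b (fst i))"
  have "(\<lambda>i. norm (b (fst i))) summable_on (UNIV \<times> (UNIV :: bool set))"
    \<comment> \<open>The factor 2 counts the cosine and the sine at each scale.\<close>
    using summable_on_cmult_right[OF summable_on_snowflake_weights[OF p], of 2]
    by (intro iffD2[OF Infinite_Sum.abs_summable_on_Sigma_iff]) (simp add: b_def abs_mult mult.assoc)
  then have b_summable: "(\<lambda>i. b (fst i)) summable_on (UNIV \<times> (UNIV :: bool set))"
    by (rule abs_summable_summable)
  have w_diff: "\<bar>w c u - w c v\<bar> \<le> min 2 \<bar>u - v\<bar>" for c u v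
  proof -
    have "\<bar>w c u\<bar> \<le> 1" "\<bar>w c v\<bar> \<le> 1"
      by (auto simp: w_def)
    then have "\<bar>w c u - w c v\<bar> \<le> 2"
      by linarith
    then show ?thesis
      by (simp add: w_def abs_cos_diff_le abs_sin_diff_le)
  qed
  have main: "(\<lambda>i. \<bar>f i x - f i y\<bar>) summable_on UNIV \<and>
      s x y \<le> B * \<bar>x - y\<bar> powr p \<and> \<bar>x - y\<bar> powr p \<le> 2 powr p / (1 - cos 1) * s x y" for x y
  \<comment> \<open>Equal points have no dyadic scale, but then every quantity is 0.\<close>
  proof (cases "x = y")
    case True
    then show ?thesis by (simp add: s_def)
  next
    case False
    define d where "d = \<bar>x - y\<bar>"
    define J where "J = \<lfloor>log 2 d\<rfloor>"
    have d: "0 < d"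
      using False by (simp add: d_def)
    have J1: "2 powr of_int J \<le> d"
      using d by (simp add: J_def le_log_iff [symmetric])
    have J2: "d < 2 powr (of_int J + 1)"
      using d by (simp add: J_def log_less_iff [symmetric])
    have f_diff: "\<bar>f (j, c) x - f (j, c) y\<bar> =
        2 powr - (of_int j * p) * \<bar>w c (2 powr of_int j * x) - w c (2 powr of_int j * y)\<bar>" for j c
      by (simp add: f_def abs_mult flip: right_diff_distrib)
    have scale: "\<bar>2 powr of_int j * x - 2 powr of_int j * y\<bar> = 2 powr of_int j * d" for j :: int
      by (simp add: d_def abs_mult flip: right_diff_distrib)
    \<comment> \<open>Dividing the distance by \<open>2 powr of_int J\<close> moves scale
      \<open>j\<close> to \<open>j + J\<close>. As the shift is a bijection, the constant
      \<open>B\<close> does not depend on the points.\<close>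
    define h :: "int \<times> bool \<Rightarrow> int \<times> bool" where "h = (\<lambda>(j, c). (j + J, c))"
    have bij: "bij_betw h UNIV UNIV"
      unfolding h_def by (rule bij_betw_byWitness[where f' = "\<lambda>(j, c). (j - J, c)"]) auto
    have term_le: "\<bar>f i x - f i y\<bar> \<le> d powr p * b (fst (h i))" for i
    proof -
      obtain j c where i: "i = (j, c)" by fastforce
      have "2 powr - (of_int j * p) = (2 powr of_int J) powr p * 2 powr - (of_int (j + J) * p)"
        by (simp add: powr_powr algebra_simps flip: powr_add)
      also have "\<dots> \<le> d powr p * 2 powr - (of_int (j + J) * p)"
        using J1 p by (intro mult_right_mono powr_mono2) auto
      finally have 1: "2 powr - (of_int j * p) \<le> d powr p * 2 powr - (of_int (j + J) * p)" .
      have "2 powr of_int j * d \<le> 2 powr of_int j * 2 powr (of_int J + 1)"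
        using J2 by (intro mult_left_mono) auto
      also have "\<dots> = 2 powr (of_int (j + J) + 1)"
        by (simp add: algebra_simps flip: powr_add)
      finally have 2: "min 2 (2 powr of_int j * d) \<le> min 2 (2 powr (of_int (j + J) + 1))"
        by simp
      have "\<bar>f i x - f i y\<bar> \<le> 2 powr - (of_int j * p) * min 2 (2 powr of_int j * d)"
        unfolding i f_diff scale [symmetric] by (intro mult_left_mono w_diff) simp
      also have "\<dots> \<le> (d powr p * 2 powr - (of_int (j + J) * p)) * min 2 (2 powr (of_int (j + J) + 1))"
        using d by (intro mult_mono 1 2) auto
      finally show ?thesis
        by (simp add: i h_def b_def mult.assoc)
    qed
    have bound_has: "((\<lambda>i. d powr p * b (fst (h i))) has_sum (d powr p * B)) UNIV"
    proof (rule has_sum_cmult_right)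
      have "((\<lambda>i. b (fst i)) has_sum B) (UNIV :: (int \<times> bool) set)"
        using has_sum_infsum[OF b_summable] by (simp add: B_def)
      then show "((\<lambda>i. b (fst (h i))) has_sum B) UNIV"
        using has_sum_reindex_bij_betw[OF bij, of "\<lambda>i. b (fst i)"] by simp
    qed
    have sum: "(\<lambda>i. \<bar>f i x - f i y\<bar>) summable_on UNIV"
      by (rule summable_on_comparison_test[OF has_sum_imp_summable[OF bound_has]])
        (use term_le in auto)
    have has: "((\<lambda>i. \<bar>f i x - f i y\<bar>) has_sum s x y) UNIV"
      unfolding s_def by (rule has_sum_infsum[OF sum])
    have upper: "s x y \<le> d powr p * B"
      by (rule has_sum_mono[OF has bound_has]) (rule term_le)
    \<comment> \<open>The lower bound needs only the scale \<open>- J\<close>: there the angles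
      differ by an amount in [1, 2], inside [0, pi], where the cosine decreases.\<close>
    have "1 - cos 1 \<le> 1 - cos \<bar>2 powr - of_int J * x - 2 powr - of_int J * y\<bar>"
    proof -
      have "2 powr - of_int J * d \<ge> 1" "2 powr - of_int J * d \<le> 2"
        using J1 J2 by (simp_all add: powr_minus powr_add field_simps)
      then have "cos (2 powr - of_int J * d) \<le> cos 1"
        using pi_gt3 by (intro cos_monotone_0_pi_le) auto
      then show ?thesis
        using scale[of "- J"] by simp
    qed
    also have "\<dots> \<le> (\<Sum>c\<in>UNIV. \<bar>w c (2 powr - of_int J * x) - w c (2 powr - of_int J * y)\<bar>)"
      using one_minus_cos_diff_le by (simp add: w_def UNIV_bool add.commute)
    finally have "2 powr (of_int J * p) * (1 - cos 1) \<le>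
        2 powr (of_int J * p) * (\<Sum>c\<in>UNIV. \<bar>w c (2 powr - of_int J * x) - w c (2 powr - of_int J * y)\<bar>)"
      by (intro mult_left_mono) auto
    also have "\<dots> = (\<Sum>i\<in>range (Pair (- J)). \<bar>f i x - f i y\<bar>)"
      by (simp add: f_diff sum_distrib_left sum.reindex inj_on_def)
    also have "\<dots> \<le> s x y"
      by (rule has_sum_mono2[OF has_sum_finite has]) auto
    finally have "2 powr (of_int J * p) * (1 - cos 1) \<le> s x y" .
    moreover have "0 < 1 - cos (1::real)"
      using cos_monotone_0_pi[of 0 1] pi_gt3 by simp
    ultimately have "2 powr (of_int J * p) \<le> s x y / (1 - cos 1)"
      by (simp add: field_simps)
    then have "2 powr p * 2 powr (of_int J * p) \<le> 2 powr p * (s x y / (1 - cos 1))"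
      by (intro mult_left_mono) auto
    \<comment> \<open>Rounding \<open>d\<close> to a power of 2 costs the factor
      \<open>2 powr p\<close>.\<close>
    moreover have "d powr p \<le> (2 powr (of_int J + 1)) powr p"
      using J2 d p by (intro powr_mono2) auto
    then have "d powr p \<le> 2 powr p * 2 powr (of_int J * p)"
      by (simp add: powr_powr algebra_simps flip: powr_add)
    ultimately have "d powr p \<le> 2 powr p / (1 - cos 1) * s x y"
      by simp
    then show ?thesis
      using sum upper by (simp add: d_def mult.commute)
  qed
  have "w c \<in> borel_measurable borel" for c
    by (cases c) (simp_all add: w_def borel_measurable_continuous_onI)
  then have f_measurable: "f i \<in> borel_measurable borel" for i
    by (cases i) (simp add: f_def)
  show ?thesis
  \<comment> \<open>The estimates hold without error and uniformly, so each coordinate uses the same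
    \<open>f\<close> and the error is 0.\<close>
  proof (rule borel_reducible_mod_ell_coordinatewise[where f = "\<lambda>_. f" and s = "\<lambda>_. s"])
    show "f i \<in> borel_measurable borel" for i
      by (rule f_measurable)
    show "summable (\<lambda>n. 0 :: real)"
      by simp
    show "((\<lambda>i. \<bar>f i x - f i y\<bar> powr 1) has_sum s x y) UNIV" for x y
      using main[of x y] by (simp add: s_def)
    show "s x y \<le> B * \<bar>x - y\<bar> powr p + 0" for x y
      using main[of x y] by simp
    show "\<bar>x - y\<bar> powr p \<le> 2 powr p / (1 - cos 1) * s x y + 0" for x y
      using main[of x y] by simp
  qed
qed

theorem corollary2p12:
  fixes p :: real
  assumes "0 < p" and "p \<le> 1"
  shows "mod_ell p \<sim>\<^sub>B mod_ell 1"
  unfolding borel_bireducible_def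
proof
  show "mod_ell p \<le>\<^sub>B mod_ell 1"
    \<comment> \<open>The embedding covers only \<open>p < 1\<close>; for \<open>p = 1\<close> the
      grid reduction with exponent 1 gives reflexivity.\<close>
    using assms mod_ell_borel_reducible_1 [of p] mod_ell_1_borel_reducible [of 1]
    by (cases "p = 1") auto
  show "mod_ell 1 \<le>\<^sub>B mod_ell p"
    using assms(1) by (rule mod_ell_1_borel_reducible)
qed

end
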